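(* Let $\mathcal{M}$ be a Markov decision process with state set $S$ and initial state $\hat{s}$, and let $\varepsilon > 0$. A set $C \subseteq S$ is an $\varepsilon$-core of $\mathcal{M}$ if and only if for every subset of states $R \subseteq S$ we have $$0 \leq \Pr^{\max}_{\mathcal{M},\hat{s}}[\Diamond R] - \Pr^{\max}_{\mathcal{M},\hat{s}}[\Diamond (R \cap C) \cap \Box C] < \varepsilon.$$
   Context: A Markov decision process (MDP) is a tuple $\mathcal{M} = (S, \hat{s}, Act, Av, \Delta)$ where $S$ is a finite set of states, $\hat{s} \in S$ is the initial state, $Act$ is a finite set of actions, $Av : S \to 2^{Act} \setminus \{\emptyset\}$ assigns to each state a non-empty set of available actions, and $\Delta$ assigns to each state $s$ and $a \in Av(s)$ a probability distribution $\Delta(s,a)$ on $S$; write $\Delta(s,a,s')$ for $\Delta(s,a)(s')$. A strategy $\pi$ maps each finite path $s_0 a_0 s_1 a_1 \dots s_n$ to a probability distribution on $Av(s_n)$ (history-dependent and randomized in general). Together with a start state $s$ it induces a probability measure $\Pr^{\pi}_{\mathcal{M},s}$ on infinite paths, and $\Pr^{\max}_{\mathcal{M},s}[A] = \sup_\pi \Pr^{\pi}_{\mathcal{M},s}[A]$ for measurable $A$. For $T \subseteq S$, $\Diamond T$ is the set of infinite paths visiting $T$ at least once (the starting state counts), and $\Box T$ is the set of infinite paths all of whose states lie in $T$. $\overline{T} = S \setminus T$. A set $C \subseteq S$ is an $\varepsilon$-core of $\mathcal{M}$ if $\Pr^{\max}_{\mathcal{M},\hat{s}}[\Diamond \overline{C}]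 < \varepsilon$. *)

theory Defs
  imports "HOL-Probability.Probability"
begin

record ('s, 'a) mdp =
  states :: "'s set"
  init :: 's
  acts :: "'a set"
  avail :: "'s \<Rightarrow> 'a set"
  transition :: "'s \<Rightarrow> 'a \<Rightarrow> 's pmf"

text \<open>The fields \<open>avail\<close> and \<open>transition\<close> are total functions; their values outside of \<open>states M\<close>
  and at unavailable actions are unconstrained and have no influence
  on any probability below.\<close>

locale MDP =
  fixes M :: "('s, 'a) mdp"
  assumes finite_states: "finite (states M)"
    and init_in_states: "init M \<in> states M"
    and finite_acts: "finite (acts M)"
    and avail_subset: "s \<in> states M \<Longrightarrow> avail M s \<subseteq> acts M"
    and avail_nonempty: "s \<in> states M \<Longrightarrow> avail M s \<noteq> {}"
    and trans_closed: "s \<in> states M \<Longrightarrow> a \<in> avail M s \<Longrightarrow> set_pmf (transition M s a) \<subseteq> states M"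

text \<open>The finite path \<open>s\<^sub>0 a\<^sub>0 s\<^sub>1 a\<^sub>1 \<dots> s\<^sub>n\<close> is the pair
  \<open>([(s\<^sub>0, a\<^sub>0), \<dots>, (s\<^sub>n\<^sub>-\<^sub>1, a\<^sub>n\<^sub>-\<^sub>1)], s\<^sub>n)\<close>, and the infinite path
  \<open>s\<^sub>0 a\<^sub>0 s\<^sub>1 a\<^sub>1 \<dots>\<close> is the sequence \<open>n \<mapsto> (s\<^sub>n, a\<^sub>n)\<close>.\<close>

inductive_set finite_paths :: "('s, 'a) mdp \<Rightarrow> (('s \<times> 'a) list \<times> 's) set"
  for M :: "('s, 'a) mdp" where
  start: "s \<in> states M \<Longrightarrow> ([], s) \<in> finite_paths M"
| step: "(h, s) \<in> finite_paths M \<Longrightarrow> a \<in> avail M s \<Longrightarrow> 0 < pmf (transition M s a) s' \<Longrightarrow>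
    (h @ [(s, a)], s') \<in> finite_paths M"

definition infinite_paths :: "('s, 'a) mdp \<Rightarrow> (nat \<Rightarrow> 's \<times> 'a) set" where
  "infinite_paths M = {\<omega>. \<forall>n. fst (\<omega> n) \<in> states M \<and> snd (\<omega> n) \<in> avail M (fst (\<omega> n)) \<and>
     0 < pmf (transition M (fst (\<omega> n)) (snd (\<omega> n))) (fst (\<omega> (Suc n)))}"

text \<open>A strategy is constrained on finite paths of \<open>M\<close> only; its other values have no influence
  on the measure below.\<close>

definition strategies :: "('s, 'a) mdp \<Rightarrow> (('s \<times> 'a) list \<Rightarrow> 's \<Rightarrow> 'a pmf) set" where
  "strategies M = {\<pi>. \<forall>(h, s) \<in> finite_paths M. set_pmf (\<pi> h s) \<subseteq> avail M s}"

definition next_state :: "('s, 'a) mdp \<Rightarrow> 's \<Rightarrow> ('s \<times> 'a) list \<Rightarrow> 's pmf" where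
  "next_state M s h = (if h = [] then return_pmf s else transition M (fst (last h)) (snd (last h)))"

definition next_step ::
  "('s, 'a) mdp \<Rightarrow> (('s \<times> 'a) list \<Rightarrow> 's \<Rightarrow> 'a pmf) \<Rightarrow> 's \<Rightarrow> ('s \<times> 'a) list \<Rightarrow> ('s \<times> 'a) pmf" where
  "next_step M \<pi> s h = bind_pmf (next_state M s h) (\<lambda>t. map_pmf (Pair t) (\<pi> h t))"

abbreviation step_space :: "('s, 'a) mdp \<Rightarrow> ('s \<times> 'a) measure" where
  "step_space M \<equiv> count_space (states M \<times> acts M)"

text \<open>\<open>next_step\<close> as a probability kernel on the finite set \<open>states M \<times> acts M\<close>. After every
  history that can occur, \<open>next_step\<close> is supported on this set, and the function pushed forward
  along is the identity there; it only serves to obtain some probability measure on this set after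
  impossible histories too.\<close>

definition step_kernel ::
  "('s, 'a) mdp \<Rightarrow> (('s \<times> 'a) list \<Rightarrow> 's \<Rightarrow> 'a pmf) \<Rightarrow> 's \<Rightarrow>
    nat \<Rightarrow> (nat \<Rightarrow> 's \<times> 'a) \<Rightarrow> ('s \<times> 'a) measure" where
  "step_kernel M \<pi> s n \<omega> = distr (measure_pmf (next_step M \<pi> s (map \<omega> [0..<n]))) (step_space M)
     (\<lambda>z. if z \<in> states M \<times> acts M then z else (SOME z. z \<in> states M \<times> acts M))"

text \<open>The probability measure induced by \<open>\<pi>\<close> and the start state \<open>s\<close>, obtained from the
  Ionescu-Tulcea theorem.\<close>

definition path_measure ::
  "('s, 'a) mdp \<Rightarrow> (('s \<times> 'a) list \<Rightarrow> 's \<Rightarrow> 'a pmf) \<Rightarrow> 's \<Rightarrow> (nat \<Rightarrow> 's \<times> 'a) measure" where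
  "path_measure M \<pi> s = projective_family.lim UNIV
     (Ionescu_Tulcea.CI (step_kernel M \<pi> s) (\<lambda>_. step_space M)) (\<lambda>_. step_space M)"

definition Pr_max :: "('s, 'a) mdp \<Rightarrow> 's \<Rightarrow> (nat \<Rightarrow> 's \<times> 'a) set \<Rightarrow> real" where
  "Pr_max M s A = (SUP \<pi> \<in> strategies M. measure (path_measure M \<pi> s) A)"

definition eventually_in :: "('s, 'a) mdp \<Rightarrow> 's set \<Rightarrow> (nat \<Rightarrow> 's \<times> 'a) set" where
  "eventually_in M T = {\<omega> \<in> infinite_paths M. \<exists>n. fst (\<omega> n) \<in> T}"

definition always_in :: "('s, 'a) mdp \<Rightarrow> 's set \<Rightarrow> (nat \<Rightarrow> 's \<times> 'a) set" where
  "always_in M T = {\<omega> \<in> infinite_paths M. \<forall>n. fst (\<omega> n) \<in> T}"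

definition eps_core :: "('s, 'a) mdp \<Rightarrow> real \<Rightarrow> 's set \<Rightarrow> bool" where
  "eps_core M \<epsilon> C \<longleftrightarrow> C \<subseteq> states M \<and> Pr_max M (init M) (eventually_in M (states M - C)) < \<epsilon>"


text \<open>The supremum in \<open>Pr_max\<close> ranges over a nonempty set, the Ionescu-Tulcea construction
  applies, the cylinder sets of \<open>path_measure\<close> have the usual
  product probabilities, and almost every sequence is an infinite path from the start state.\<close>

context MDP
begin

lemma steps_nonempty: "states M \<times> acts M \<noteq> {}"
  using init_in_states avail_subset avail_nonempty by fastforce

lemma some_step: "(SOME z. z \<in> states M \<times> acts M) \<in> states M \<times> acts M"
  using steps_nonempty by (metis ex_in_conv someI_ex)

lemma prob_space_step_kernel: "prob_space (step_kernel M \<pi> s n \<omega>)"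
  unfolding step_kernel_def using some_step
  by (intro prob_space.prob_space_distr prob_space_measure_pmf) auto

lemma Ionescu_Tulcea_step_kernel: "Ionescu_Tulcea (step_kernel M \<pi> s) (\<lambda>_. step_space M)"
proof (rule Ionescu_Tulcea.intro)
  fix n :: nat
  have "PiM {0..<n} (\<lambda>_. step_space M) = count_space (PiE {0..<n} (\<lambda>_. states M \<times> acts M))"
    by (rule count_space_PiM_finite) (auto intro!: countable_finite finite_cartesian_product finite_states finite_acts)
  moreover have "step_kernel M \<pi> s n \<omega> \<in> space (subprob_algebra (step_space M))" for \<omega>
    using prob_space_step_kernel[of \<pi> s n \<omega>]
    by (auto simp: space_subprob_algebra step_kernel_def intro: prob_space_imp_subprob_space)
  ultimately show "step_kernel M \<pi> s n \<in> measurable (PiM {0..<n} (\<lambda>_. step_space M))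
      (subprob_algebra (step_space M))"
    by simp
qed (rule prob_space_step_kernel)

lemma sets_path_measure: "sets (path_measure M \<pi> s) = sets (PiM UNIV (\<lambda>_. step_space M))"
proof -
  interpret Ionescu_Tulcea "step_kernel M \<pi> s" "\<lambda>_. step_space M"
    by (rule Ionescu_Tulcea_step_kernel)
  show ?thesis by (simp add: path_measure_def)
qed

lemma space_path_measure: "space (path_measure M \<pi> s) = UNIV \<rightarrow>\<^sub>E states M \<times> acts M"
  using sets_eq_imp_space_eq[OF sets_path_measure] by (simp add: space_PiM)

lemma prob_space_path_measure: "prob_space (path_measure M \<pi> s)"
proof -
  interpret Ionescu_Tulcea "step_kernel M \<pi> s" "\<lambda>_. step_space M"
    by (rule Ionescu_Tulcea_step_kernel)
  have "emeasure PF.lim (space PF.lim) = emeasure (CI {}) (space (CI {}))"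
    using lim[of "{}" "space (PiM {} (\<lambda>_. step_space M))", OF _ sets.top]
    by (simp add: PF.space_P prod_emb_def space_PiM vimage_def restrict_def)
  also have "\<dots> = 1"
    by (rule prob_space.emeasure_space_1[OF PF.prob_space_P]) auto
  finally show ?thesis
    by (intro prob_spaceI) (simp add: path_measure_def)
qed

lemma next_step_finite_path:
  assumes \<pi>: "\<pi> \<in> strategies M" and s: "s \<in> states M"
    and h: "h = [] \<or> (butlast h, fst (last h)) \<in> finite_paths M \<and> snd (last h) \<in> avail M (fst (last h))"
    and ta: "(t, a) \<in> set_pmf (next_step M \<pi> s h)"
  shows "(h, t) \<in> finite_paths M" "a \<in> avail M t"
proof -
  have t: "t \<in> set_pmf (next_state M s h)" and a: "a \<in> set_pmf (\<pi> h t)"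
    using ta by (auto simp: next_step_def)
  show *: "(h, t) \<in> finite_paths M"
  proof (cases "h = []")
    case True
    then show ?thesis using t s by (auto simp: next_state_def intro: finite_paths.start)
  next
    case False
    then have "(butlast h @ [(fst (last h), snd (last h))], t) \<in> finite_paths M"
      using t h by (intro finite_paths.step) (auto simp: next_state_def pmf_positive_iff)
    with False show ?thesis by simp
  qed
  show "a \<in> avail M t"
    using \<pi> * a by (auto simp: strategies_def)
qed

lemma finite_path_last_state: "(h, t) \<in> finite_paths M \<Longrightarrow> t \<in> states M"
  by (induction rule: finite_paths.induct) (use trans_closed in \<open>auto simp: pmf_positive_iff\<close>)

lemma next_step_support:
  assumes \<pi>: "\<pi> \<in> strategies M" and s: "s \<in> states M"
    and h: "h = [] \<or> (butlast h, fst (last h)) \<in> finite_paths M \<and> snd (last h) \<in> avail M (fst (last h))"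
  shows "set_pmf (next_step M \<pi> s h) \<subseteq> states M \<times> acts M"
  using next_step_finite_path[OF assms] finite_path_last_state avail_subset by fastforce

lemma pmf_next_step: "pmf (next_step M \<pi> s h) (t, a) = pmf (next_state M s h) t * pmf (\<pi> h t) a"
proof -
  have "pmf (map_pmf (Pair t') (\<pi> h t')) (t, a) = indicator {t} t' * pmf (\<pi> h t) a" for t'
  proof (cases "t' = t")
    case True
    then show ?thesis by (simp add: pmf_map_inj' inj_on_def)
  next
    case False
    then show ?thesis by (auto simp: pmf_eq_0_set_pmf)
  qed
  then show ?thesis
    by (simp add: next_step_def pmf_bind measure_pmf_single)
qed

lemma emeasure_step_kernel:
  assumes "set_pmf (next_step M \<pi> s (map \<omega> [0..<n])) \<subseteq> states M \<times> acts M" and "z \<in> states M \<times> acts M"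
  shows "emeasure (step_kernel M \<pi> s n \<omega>) {z} = pmf (next_step M \<pi> s (map \<omega> [0..<n])) z"
proof -
  let ?p = "next_step M \<pi> s (map \<omega> [0..<n])"
  let ?f = "\<lambda>z. if z \<in> states M \<times> acts M then z else (SOME z. z \<in> states M \<times> acts M)"
  have "emeasure (step_kernel M \<pi> s n \<omega>) {z} = emeasure ?p (?f -` {z})"
    unfolding step_kernel_def using some_step assms(2) by (subst emeasure_distr) auto
  also have "\<dots> = emeasure ?p {z}"
    using assms by (intro emeasure_eq_AE) (auto simp: AE_measure_pmf_iff)
  finally show ?thesis by (simp add: emeasure_pmf_single)
qed

theorem emeasure_path_measure_cylinder:
  assumes \<pi>: "\<pi> \<in> strategies M" and s: "s \<in> states M"
    and set_h: "set h \<subseteq> states M \<times> acts M"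
    and h: "\<And>i. Suc i < length h \<Longrightarrow> (take i h, fst (h ! i)) \<in> finite_paths M \<and> snd (h ! i) \<in> avail M (fst (h ! i))"
  shows "emeasure (path_measure M \<pi> s) {\<omega> \<in> space (path_measure M \<pi> s). \<forall>i<length h. \<omega> i = h ! i} =
    (\<Prod>i<length h. pmf (next_state M s (take i h)) (fst (h ! i)) *
       pmf (\<pi> (take i h) (fst (h ! i))) (snd (h ! i)))"
proof -
  interpret Ionescu_Tulcea "step_kernel M \<pi> s" "\<lambda>_. step_space M"
    by (rule Ionescu_Tulcea_step_kernel)
  define w where "w n = (\<lambda>i\<in>{0..<n}. h ! i)" for n
  have hi: "h ! i \<in> states M \<times> acts M" if "i < length h" for i
    using set_h nth_mem[OF that] by blast
  have PiM_eq: "PiM {0..<n} (\<lambda>_. step_space M) = count_space ({0..<n} \<rightarrow>\<^sub>E states M \<times> acts M)" for n :: nat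
    by (rule count_space_PiM_finite) (auto intro!: countable_finite finite_cartesian_product finite_states finite_acts)
  have w: "w n \<in> {0..<n} \<rightarrow>\<^sub>E states M \<times> acts M" if "n \<le> length h" for n
    using that hi by (auto simp: w_def simp del: mem_Sigma_iff)
  have w_sets: "{w n} \<in> sets (PiM {0..<n} (\<lambda>_. step_space M))" if "n \<le> length h" for n
    using w[OF that] by (simp add: PiM_eq)
  have w_space: "w n \<in> space (PiM {0..<n} (\<lambda>_. step_space M))" if "n \<le> length h" for n
    using w[OF that] by (simp add: PiM_eq)
  have map_w: "map (w n) [0..<n] = take n h" if "n \<le> length h" for n
    using that by (auto simp: w_def intro!: nth_equalityI)
  have supp: "set_pmf (next_step M \<pi> s (take n h)) \<subseteq> states M \<times> acts M" if "n < length h" for n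
  proof (rule next_step_support[OF \<pi> s])
    show "take n h = [] \<or> (butlast (take n h), fst (last (take n h))) \<in> finite_paths M \<and>
        snd (last (take n h)) \<in> avail M (fst (last (take n h)))"
      using h[of "n - 1"] that by (cases n) (auto simp: take_Suc_conv_app_nth)
  qed
  have C_cyl: "emeasure (C 0 n (\<lambda>_. undefined)) {w n} =
      (\<Prod>i<n. pmf (next_step M \<pi> s (take i h)) (h ! i))" if "n \<le> length h" for n
    using that
  proof (induction n)
    case 0
    then show ?case
      by (simp add: w_def PiM_empty fun_eq_iff restrict_def)
  next
    case (Suc n)
    then have n: "n < length h" by simp
    have eP: "emeasure (eP n x) {w (Suc n)} =
        ennreal (pmf (next_step M \<pi> s (take n h)) (h ! n)) * indicator {w n} x"
      if x: "x \<in> space (PiM {0..<n} (\<lambda>_. step_space M))" for x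
    proof (cases "x = w n")
      case True
      have "(\<lambda>y. (w n)(n := y)) -` {w (Suc n)} \<inter> space (step_space M) = {h ! n}"
        using hi[OF n] by (auto simp: w_def fun_eq_iff restrict_def split: if_splits)
      then show ?thesis
        using True n x supp[OF n] hi[OF n]
        by (simp add: emeasure_eP w_sets emeasure_step_kernel map_w del: mem_Sigma_iff)
    next
      case False
      have "x = w n" if "x(n := y) = w (Suc n)" for y
      proof
        fix i
        show "x i = w n i"
          using fun_cong[OF that, of i] x
          by (auto simp: w_def PiM_eq PiE_iff extensional_def restrict_def split: if_splits)
      qed
      with False have "(\<lambda>y. x(n := y)) -` {w (Suc n)} \<inter> space (step_space M) = {}"
        by auto
      with False show ?thesis
        using Suc.prems by (simp add: emeasure_eP[OF x] w_sets)
    qed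
    have "emeasure (C 0 (Suc n) (\<lambda>_. undefined)) {w (Suc n)} =
        (\<integral>\<^sup>+x. emeasure (eP n x) {w (Suc n)} \<partial>C 0 n (\<lambda>_. undefined))"
      unfolding C.simps add_0
    proof (rule emeasure_bind)
      show "space (C 0 n (\<lambda>_. undefined)) \<noteq> {}"
        using steps_nonempty by (auto simp: space_C)
      show "eP n \<in> measurable (C 0 n (\<lambda>_. undefined)) (subprob_algebra (PiM {0..<Suc n} (\<lambda>_. step_space M)))"
        using measurable_eP[of n] by (simp add: measurable_cong_sets[OF sets_C refl])
      show "{w (Suc n)} \<in> sets (PiM {0..<Suc n} (\<lambda>_. step_space M))"
        using Suc.prems by (rule w_sets)
    qed
    also have "\<dots> = (\<integral>\<^sup>+x. ennreal (pmf (next_step M \<pi> s (take n h)) (h ! n)) * indicator {w n} x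
        \<partial>C 0 n (\<lambda>_. undefined))"
      by (intro nn_integral_cong eP) (simp add: space_C)
    also have "\<dots> = ennreal (pmf (next_step M \<pi> s (take n h)) (h ! n)) *
        emeasure (C 0 n (\<lambda>_. undefined)) {w n}"
      using w_sets[of n] n by (subst nn_integral_cmult_indicator) (auto simp: sets_C)
    finally show ?case
      using Suc by (simp add: ennreal_mult prod_nonneg mult.commute)
  qed
  have "{\<omega> \<in> space (path_measure M \<pi> s). \<forall>i<length h. \<omega> i = h ! i} =
      PF.emb UNIV {0..<length h} {w (length h)}"
    by (auto simp: space_path_measure prod_emb_def w_def restrict_def fun_eq_iff) metis
  then have "emeasure (path_measure M \<pi> s) {\<omega> \<in> space (path_measure M \<pi> s). \<forall>i<length h. \<omega> i = h ! i} =
      emeasure (CI {0..<length h}) {w (length h)}"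
    using lim[of "{0..<length h}" "{w (length h)}"] w_sets[of "length h"]
    by (simp add: path_measure_def)
  also have "\<dots> = emeasure (C 0 (length h) (\<lambda>_. undefined)) {w (length h)}"
  proof -
    have "PF.emb {0..<length h} {0..<length h} {w (length h)} = {w (length h)}"
      using w[of "length h"] by (intro prod_emb_id) auto
    then show ?thesis
      using emeasure_CI[of "{0..<length h}" "length h", OF _ w_sets] by simp
  qed
  finally show ?thesis
    by (simp add: C_cyl pmf_next_step[symmetric])
qed

lemma measurable_step: "(\<lambda>\<omega>. \<omega> n) \<in> measurable (path_measure M \<pi> s) (step_space M)"
  unfolding measurable_cong_sets[OF sets_path_measure[of \<pi> s] refl]
  by (rule measurable_component_singleton) (rule UNIV_I)

lemma sets_cylinder:
  assumes "set h \<subseteq> states M \<times> acts M"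
  shows "{\<omega> \<in> space (path_measure M \<pi> s). \<forall>i<length h. \<omega> i = h ! i} \<in> sets (path_measure M \<pi> s)"
proof -
  have single: "{\<omega> \<in> space (path_measure M \<pi> s). \<omega> i = h ! i} \<in> sets (path_measure M \<pi> s)"
    if "i < length h" for i
  proof -
    have "{h ! i} \<in> sets (step_space M)"
      using subsetD[OF assms nth_mem[OF that]] by (simp del: mem_Sigma_iff)
    from measurable_sets[OF measurable_step[of i] this]
    have "(\<lambda>\<omega>. \<omega> i) -` {h ! i} \<inter> space (path_measure M \<pi> s) \<in> sets (path_measure M \<pi> s)" .
    moreover have "(\<lambda>\<omega>. \<omega> i) -` {h ! i} \<inter> space (path_measure M \<pi> s) =
        {\<omega> \<in> space (path_measure M \<pi> s). \<omega> i = h ! i}" by blast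
    ultimately show ?thesis by (simp only:)
  qed
  have "{\<omega> \<in> space (path_measure M \<pi> s). \<forall>i\<in>{..<length h}. \<omega> i = h ! i} \<in> sets (path_measure M \<pi> s)"
    by (rule sets.sets_Collect_finite_All) (simp_all only: single lessThan_iff finite_lessThan)
  then show ?thesis by (simp only: Ball_def lessThan_iff)
qed

lemma strategies_nonempty: "strategies M \<noteq> {}"
proof -
  have "(\<lambda>h s. return_pmf (SOME a. a \<in> avail M s)) \<in> strategies M"
    using finite_path_last_state avail_nonempty by (fastforce simp: strategies_def some_in_eq)
  then show ?thesis by blast
qed

lemma infinite_paths_subset_space: "infinite_paths M \<subseteq> space (path_measure M \<pi> s)"
proof
  fix \<omega> assume *: "\<omega> \<in> infinite_paths M"
  have "\<omega> n \<in> states M \<times> acts M" for n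
  proof -
    have "fst (\<omega> n) \<in> states M" "snd (\<omega> n) \<in> avail M (fst (\<omega> n))"
      using * unfolding infinite_paths_def by blast+
    with avail_subset show ?thesis unfolding mem_Times_iff by blast
  qed
  then show "\<omega> \<in> space (path_measure M \<pi> s)"
    unfolding space_path_measure by blast
qed

lemma sets_infinite_paths: "infinite_paths M \<in> sets (path_measure M \<pi> s)"
proof -
  let ?N = "path_measure M \<pi> s"
  have pair: "(\<lambda>\<omega>. (\<omega> n, \<omega> (Suc n))) \<in>
      measurable ?N (count_space ((states M \<times> acts M) \<times> (states M \<times> acts M)))" for n
    using measurable_Pair[OF measurable_step[of n] measurable_step[of "Suc n"]]
    by (simp add: pair_measure_count_space finite_states finite_acts)
  have "infinite_paths M = (\<Inter>n. {\<omega> \<in> space ?N. fst (\<omega> n) \<in> states M \<and> snd (\<omega> n) \<in> avail M (fst (\<omega> n)) \<and>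
      0 < pmf (transition M (fst (\<omega> n)) (snd (\<omega> n))) (fst (\<omega> (Suc n)))})"
    using infinite_paths_subset_space[of \<pi> s] by (auto simp: infinite_paths_def)
  also have "\<dots> \<in> sets ?N"
  proof (intro sets.countable_INT' image_subsetI)
    fix n
    let ?Q = "{z \<in> (states M \<times> acts M) \<times> (states M \<times> acts M). fst (fst z) \<in> states M \<and>
      snd (fst z) \<in> avail M (fst (fst z)) \<and> 0 < pmf (transition M (fst (fst z)) (snd (fst z))) (fst (snd z))}"
    have "(\<lambda>\<omega>. (\<omega> n, \<omega> (Suc n))) -` ?Q \<inter> space ?N \<in> sets ?N"
      by (rule measurable_sets[OF pair]) auto
    also have "(\<lambda>\<omega>. (\<omega> n, \<omega> (Suc n))) -` ?Q \<inter> space ?N =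
      {\<omega> \<in> space ?N. fst (\<omega> n) \<in> states M \<and> snd (\<omega> n) \<in> avail M (fst (\<omega> n)) \<and>
        0 < pmf (transition M (fst (\<omega> n)) (snd (\<omega> n))) (fst (\<omega> (Suc n)))}"
      by (auto simp: space_path_measure PiE_iff mem_Times_iff)
    finally show "{\<omega> \<in> space ?N. fst (\<omega> n) \<in> states M \<and> snd (\<omega> n) \<in> avail M (fst (\<omega> n)) \<and>
        0 < pmf (transition M (fst (\<omega> n)) (snd (\<omega> n))) (fst (\<omega> (Suc n)))} \<in> sets ?N" .
  qed auto
  finally show ?thesis .
qed

theorem AE_infinite_paths:
  assumes \<pi>: "\<pi> \<in> strategies M" and s: "s \<in> states M"
  shows "AE \<omega> in path_measure M \<pi> s. \<omega> \<in> infinite_paths M \<and> fst (\<omega> 0) = s"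
proof -
  let ?N = "path_measure M \<pi> s"
  let ?ok = "\<lambda>h i. (take i h, fst (h ! i)) \<in> finite_paths M \<and> snd (h ! i) \<in> avail M (fst (h ! i))"
  define H where "H = {h \<in> lists (states M \<times> acts M). h \<noteq> [] \<and> (\<forall>i. Suc i < length h \<longrightarrow> ?ok h i) \<and>
    last h \<notin> set_pmf (next_step M \<pi> s (butlast h))}"
  have "countable (lists (states M \<times> acts M))"
    by (intro countable_lists countable_finite finite_cartesian_product finite_states finite_acts)
  then have "countable H"
    by (rule countable_subset[rotated]) (auto simp: H_def)
  have *: "AE \<omega> in ?N. \<not> (\<forall>i<length h. \<omega> i = h ! i)" if "h \<in> H" for h
  proof (rule AE_I')
    let ?E = "{\<omega> \<in> space ?N. \<forall>i<length h. \<omega> i = h ! i}"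
    have h: "set h \<subseteq> states M \<times> acts M" "h \<noteq> []" "\<And>i. Suc i < length h \<Longrightarrow> ?ok h i"
      "last h \<notin> set_pmf (next_step M \<pi> s (butlast h))"
      using that unfolding H_def lists_eq_set by blast+
    define n where "n = length h - 1"
    have n: "n < length h" "butlast h = take n h" "last h = h ! n"
      using h(2) by (auto simp: n_def butlast_conv_take last_conv_nth)
    have "pmf (next_step M \<pi> s (take n h)) (fst (h ! n), snd (h ! n)) = 0"
      using h(4) by (simp only: n prod.collapse pmf_eq_0_set_pmf simp_thms)
    then have "(\<Prod>i<length h. pmf (next_state M s (take i h)) (fst (h ! i)) *
       pmf (\<pi> (take i h) (fst (h ! i))) (snd (h ! i))) = 0"
      unfolding pmf_next_step using n(1) by (intro prod_zero) auto
    then have "emeasure ?N ?E = 0"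
      using emeasure_path_measure_cylinder[OF \<pi> s h(1,3)] by (metis ennreal_0)
    moreover have "?E \<in> sets ?N"
      by (rule sets_cylinder[OF h(1)])
    ultimately show "?E \<in> null_sets ?N" by (rule null_setsI)
  qed blast
  have "AE \<omega> in ?N. \<forall>h\<in>H. \<not> (\<forall>i<length h. \<omega> i = h ! i)"
    unfolding AE_ball_countable[OF \<open>countable H\<close>] using * by (rule ballI)
  then show ?thesis
    using AE_space
  proof eventually_elim
    case (elim \<omega>)
    have space: "\<omega> n \<in> states M \<times> acts M" for n
      using elim(2) by (auto simp: space_path_measure simp del: mem_Sigma_iff)
    have step: "\<omega> n \<in> set_pmf (next_step M \<pi> s (map \<omega> [0..<n])) \<and>
        (map \<omega> [0..<n], fst (\<omega> n)) \<in> finite_paths M \<and> snd (\<omega> n) \<in> avail M (fst (\<omega> n))" for n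
    proof (induction n rule: less_induct)
      case (less n)
      have supp: "\<omega> n \<in> set_pmf (next_step M \<pi> s (map \<omega> [0..<n]))"
      proof (rule ccontr)
        assume "\<omega> n \<notin> set_pmf (next_step M \<pi> s (map \<omega> [0..<n]))"
        moreover have "?ok (map \<omega> [0..<Suc n]) i" if "i < n" for i
          using less[OF that] that by (simp add: take_map del: upt_Suc)
        moreover have "map \<omega> [0..<Suc n] \<in> lists (states M \<times> acts M)"
          unfolding lists_eq_set mem_Collect_eq set_map using space by (intro image_subsetI)
        ultimately have "map \<omega> [0..<Suc n] \<in> H"
          by (simp add: H_def butlast_append)
        with elim(1) show False by (force simp del: upt_Suc)
      qed
      have "map \<omega> [0..<n] = [] \<or> (butlast (map \<omega> [0..<n]), fst (last (map \<omega> [0..<n]))) \<in> finite_paths M \<and>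
          snd (last (map \<omega> [0..<n])) \<in> avail M (fst (last (map \<omega> [0..<n])))"
        using less[of "n - 1"] by (cases n) auto
      from next_step_finite_path[OF \<pi> s this, of "fst (\<omega> n)" "snd (\<omega> n)"] supp show ?case by simp
    qed
    have "fst (\<omega> (Suc n)) \<in> set_pmf (transition M (fst (\<omega> n)) (snd (\<omega> n)))" for n
      using step[of "Suc n"] by (auto simp: next_step_def next_state_def)
    moreover have "fst (\<omega> 0) = s"
      using step[of 0] by (auto simp: next_step_def next_state_def)
    ultimately show ?case
      using step space by (auto simp: infinite_paths_def pmf_positive_iff mem_Times_iff)
  qed
qed

end

end

theory Submission
  imports Defs
begin

text \<open>A path that visits R either leaves C at some time, or stays in C and then meets R inside
  C. So \<open>eventually_in M R\<close> is covered by the event subtracted from it in the theorem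
  together with \<open>eventually_in M (states M - C)\<close>. As a supremum of probabilities,
  \<open>Pr_max\<close> is monotone (\<open>Pr_max_mono\<close>) and subadditive
  (\<open>Pr_max_Un_le\<close>). Monotonicity makes the difference nonnegative, and subadditivity
  bounds it by the probability of leaving C, which is below \<epsilon> for a core. Conversely, for R
  the complement of C the subtracted event is empty, so the bound on the difference is the core
  condition itself.\<close>

context MDP
begin

lemma sets_eventually_in: "eventually_in M T \<in> sets (path_measure M \<pi> s)"
proof -
  let ?N = "path_measure M \<pi> s"
  \<comment> \<open>Restricting to pairs in \<open>states M \<times> acts M\<close> makes this a
    measurable set of \<open>step_space M\<close>.\<close>
  have "(\<lambda>\<omega>. \<omega> n) -` {z \<in> states M \<times> acts M. fst z \<in> T} \<inter> space ?N =
      {\<omega> \<in> space ?N. fst (\<omega> n) \<in> T}" for n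
    by (auto simp: space_path_measure PiE_iff simp del: mem_Sigma_iff)
  then have "eventually_in M T =
      infinite_paths M \<inter> (\<Union>n. (\<lambda>\<omega>. \<omega> n) -` {z \<in> states M \<times> acts M. fst z \<in> T} \<inter> space ?N)"
    using infinite_paths_subset_space[of \<pi> s] unfolding eventually_in_def by auto
  also have "\<dots> \<in> sets ?N"
    by (intro sets.Int sets_infinite_paths sets.countable_UN image_subsetI
        measurable_sets[OF measurable_step]) auto
  finally show ?thesis .
qed

lemma infinite_paths_state: "\<omega> \<in> infinite_paths M \<Longrightarrow> fst (\<omega> n) \<in> states M"
  unfolding infinite_paths_def by blast

text \<open>This reduces measurability of \<open>always_in\<close> to that of
  \<open>eventually_in\<close>, and it supplies the dichotomy between staying in C and leaving
  it.\<close>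

lemma always_in_eq: "always_in M T = infinite_paths M - eventually_in M (states M - T)"
  using infinite_paths_state unfolding always_in_def eventually_in_def by blast

lemma sets_always_in: "always_in M T \<in> sets (path_measure M \<pi> s)"
  unfolding always_in_eq by (intro sets.Diff sets_infinite_paths sets_eventually_in)

text \<open>A real supremum is an upper bound only for a set bounded above; here 1 is such a
  bound.\<close>

lemma measure_le_Pr_max: "\<pi> \<in> strategies M \<Longrightarrow> measure (path_measure M \<pi> s) A \<le> Pr_max M s A"
  unfolding Pr_max_def
  by (intro cSUP_upper bdd_aboveI2[of _ _ 1] prob_space.prob_le_1 prob_space_path_measure)

lemma Pr_max_least:
  "(\<And>\<pi>. \<pi> \<in> strategies M \<Longrightarrow> measure (path_measure M \<pi> s) A \<le> x) \<Longrightarrow> Pr_max M s A \<le> x"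
  unfolding Pr_max_def by (rule cSUP_least[OF strategies_nonempty])

text \<open>Measurability is asked for every \<pi> because the measure varies with the strategy; all
  these measures share the product sigma-algebra.\<close>

lemma Pr_max_mono:
  assumes "A \<subseteq> B" and "\<And>\<pi>. B \<in> sets (path_measure M \<pi> s)"
  shows "Pr_max M s A \<le> Pr_max M s B"
proof (rule Pr_max_least)
  fix \<pi> assume \<pi>: "\<pi> \<in> strategies M"
  interpret prob_space "path_measure M \<pi> s" by (rule prob_space_path_measure)
  show "measure (path_measure M \<pi> s) A \<le> Pr_max M s B"
    using finite_measure_mono[OF assms(1) assms(2)[of \<pi>]] measure_le_Pr_max[OF \<pi>] by (rule order_trans)
qed

text \<open>The union bound holds under each single strategy, and each summand is then bounded by
  its own supremum. Different strategies may be best for A and for B, so the inequality can be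
  strict even for disjoint events.\<close>

lemma Pr_max_Un_le:
  assumes "\<And>\<pi>. A \<in> sets (path_measure M \<pi> s)" and "\<And>\<pi>. B \<in> sets (path_measure M \<pi> s)"
  shows "Pr_max M s (A \<union> B) \<le> Pr_max M s A + Pr_max M s B"
proof (rule Pr_max_least)
  fix \<pi> assume \<pi>: "\<pi> \<in> strategies M"
  interpret prob_space "path_measure M \<pi> s" by (rule prob_space_path_measure)
  have "measure (path_measure M \<pi> s) (A \<union> B) \<le>
      measure (path_measure M \<pi> s) A + measure (path_measure M \<pi> s) B"
    by (rule measure_Un_le[OF assms])
  also have "\<dots> \<le> Pr_max M s A + Pr_max M s B"
    by (intro add_mono measure_le_Pr_max \<pi>)
  finally show "measure (path_measure M \<pi> s) (A \<union> B) \<le> Pr_max M s A + Pr_max M s B" .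
qed

lemma Pr_max_empty [simp]: "Pr_max M s {} = 0"
  by (simp add: Pr_max_def strategies_nonempty)

end

theorem theorem3p2:
  fixes M :: "('s, 'a) mdp" and \<epsilon> :: real and C :: "'s set"
  assumes "MDP M" and "0 < \<epsilon>" and "C \<subseteq> states M"
  shows "eps_core M \<epsilon> C \<longleftrightarrow>
    (\<forall>R \<subseteq> states M.
      0 \<le> Pr_max M (init M) (eventually_in M R) -
           Pr_max M (init M) (eventually_in M (R \<inter> C) \<inter> always_in M C) \<and>
      Pr_max M (init M) (eventually_in M R) -
           Pr_max M (init M) (eventually_in M (R \<inter> C) \<inter> always_in M C) < \<epsilon>)"
proof -
  interpret MDP M by fact
  let ?P = "Pr_max M (init M)" and ?E = "eventually_in M"
  let ?A = "\<lambda>R. ?E (R \<inter> C) \<inter> always_in M C"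
  show ?thesis
  proof
    assume "eps_core M \<epsilon> C"
    then have core: "?P (?E (states M - C)) < \<epsilon>" by (simp add: eps_core_def)
    show "\<forall>R \<subseteq> states M. 0 \<le> ?P (?E R) - ?P (?A R) \<and> ?P (?E R) - ?P (?A R) < \<epsilon>"
    proof (intro allI impI conjI)
      fix R assume "R \<subseteq> states M"
      have "?P (?A R) \<le> ?P (?E R)"
        by (intro Pr_max_mono sets_eventually_in) (auto simp: eventually_in_def)
      then show "0 \<le> ?P (?E R) - ?P (?A R)" by simp
      \<comment> \<open>A path that visits R and never visits \<open>states M - C\<close> has all
        its states in C, so its visit to R happens in \<open>R \<inter> C\<close>.\<close>
      have "?E R \<subseteq> ?A R \<union> ?E (states M - C)"
        using infinite_paths_state unfolding always_in_eq eventually_in_def by blast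
      then have "?P (?E R) \<le> ?P (?A R \<union> ?E (states M - C))"
        by (intro Pr_max_mono sets.Un sets.Int sets_eventually_in sets_always_in)
      also have "\<dots> \<le> ?P (?A R) + ?P (?E (states M - C))"
        by (intro Pr_max_Un_le sets.Int sets_eventually_in sets_always_in)
      finally show "?P (?E R) - ?P (?A R) < \<epsilon>" using core by simp
    qed
  next
    assume *: "\<forall>R \<subseteq> states M. 0 \<le> ?P (?E R) - ?P (?A R) \<and> ?P (?E R) - ?P (?A R) < \<epsilon>"
    \<comment> \<open>The hypothesis is used at R = \<open>states M - C\<close>, which is disjoint
      from C, so the subtracted probability vanishes.\<close>
    have "?A (states M - C) = {}" by (auto simp: eventually_in_def)
    moreover have "?P (?E (states M - C)) - ?P (?A (states M - C)) < \<epsilon>"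
      using * by blast
    ultimately have "?P (?E (states M - C)) < \<epsilon>" by simp
    with assms(3) show "eps_core M \<epsilon> C" by (simp add: eps_core_def)
  qed
qed

end
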